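(* Let $q\ge 3$ (even or odd) and let $\mathbf f\in A_q^+$ be a forbidden factor whose last symbol is $q-1$. Then $\mathbf f$ does not induce zero periodicity on $A_q^\infty$ if and only if $\mathbf f\in W_q$.
   Context: $A_q=\{0,1,\dots,q-1\}$. $A_q^*$ (resp. $A_q^+$) is the set of all (resp. nonempty) finite words over $A_q$, $A_q^\infty$ the set of right-infinite words; $\mathbf a^i$ is $i$-fold concatenation, $\mathbf a^\infty=\mathbf a\mathbf a\cdots$. For a set $X$ of words, $X(\mathbf f)$ is the set of words of $X$ not containing $\mathbf f$ as a factor (contiguous subword), and $\mathbf p|X$ the words of $X$ with prefix $\mathbf p$. An infinite word has ultimate period $\mathbf c\ne\epsilon$ if it equals $\mathbf b\mathbf c^\infty$ for a finite word $\mathbf b$. For distinct words $\mathbf s,\mathbf t$ of the same (finite or infinite) length, let $k$ be the leftmost differing position, $u=\sum_{i<k}s_i$, $v$ the number of nonzero symbols among $s_1,\dots,s_{k-1}$. $\mathbf s\prec\mathbf t$ iff ($u$ even and $s_k<t_k$) or ($u$ odd and $s_k>t_k$); $\mathbf s\triangleleft\mathbf t$ iff ($u+v$ even and $s_k<t_k$) or ($u+v$ odd and $s_k>t_k$). The appropriate order is $\prec$ for even $q$ and $\triangleleft$ for odd $q$; first/last mean least/greatest in it. $\mathbf f$ induces zero periodicity on $A_q^\infty$ if for every $\mathbf p\in A_q^*(\mathbf f)$ the first and last words of $\mathbf p|A_q^\infty(\mathbf f)$ both have ultimate period $0$. $W_q=\{(q-2)^\ell(q-1):\ell\ge 0\}$.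 *)

theory Defs
  imports "HOL-Library.Omega_Words_Fun" "HOL-Library.Sublist"
begin

definition alphabet :: "nat \<Rightarrow> nat set" where
  "alphabet q = {0..<q}"

definition inf_words :: "nat \<Rightarrow> nat word set" where
  "inf_words q = {w. range w \<subseteq> alphabet q}"

definition inf_factor :: "'a list \<Rightarrow> 'a word \<Rightarrow> bool" where
  "inf_factor f w \<longleftrightarrow> (\<exists>u x. w = u \<frown> f \<frown> x)"

definition fin_avoiding :: "nat \<Rightarrow> nat list \<Rightarrow> nat list set" where
  "fin_avoiding q f = {p \<in> lists (alphabet q). \<not> sublist f p}"

definition inf_avoiding :: "nat \<Rightarrow> nat list \<Rightarrow> nat word set" where
  "inf_avoiding q f = {w \<in> inf_words q. \<not> inf_factor f w}"

definition with_prefix :: "'a list \<Rightarrow> 'a word set \<Rightarrow> 'a word set" where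
  "with_prefix p X = {w \<in> X. \<exists>x. w = p \<frown> x}"

definition has_ultimate_period :: "'a word \<Rightarrow> 'a list \<Rightarrow> bool" where
  "has_ultimate_period w c \<longleftrightarrow> c \<noteq> [] \<and> (\<exists>b. w = b \<frown> c\<^sup>\<omega>)"

text \<open>Positions are counted from 0, so the symbols preceding the leftmost differing
  position \<open>k\<close> are those with index \<open>i < k\<close>.\<close>

definition prec :: "nat word \<Rightarrow> nat word \<Rightarrow> bool" where
  "prec s t \<longleftrightarrow> (\<exists>k. (\<forall>i<k. s i = t i) \<and> s k \<noteq> t k \<and>
     (let u = (\<Sum>i<k. s i)
      in (even u \<and> s k < t k) \<or> (odd u \<and> s k > t k)))"

definition tri :: "nat word \<Rightarrow> nat word \<Rightarrow> bool" where
  "tri s t \<longleftrightarrow> (\<exists>k. (\<forall>i<k. s i = t i) \<and> s k \<noteq> t k \<and>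
     (let u = (\<Sum>i<k. s i); v = card {i. i < k \<and> s i \<noteq> 0}
      in (even (u + v) \<and> s k < t k) \<or> (odd (u + v) \<and> s k > t k)))"

definition appropriate_order :: "nat \<Rightarrow> nat word \<Rightarrow> nat word \<Rightarrow> bool" where
  "appropriate_order q = (if even q then prec else tri)"

definition is_first :: "('a \<Rightarrow> 'a \<Rightarrow> bool) \<Rightarrow> 'a set \<Rightarrow> 'a \<Rightarrow> bool" where
  "is_first R X w \<longleftrightarrow> w \<in> X \<and> (\<forall>x\<in>X. x \<noteq> w \<longrightarrow> R w x)"

definition is_last :: "('a \<Rightarrow> 'a \<Rightarrow> bool) \<Rightarrow> 'a set \<Rightarrow> 'a \<Rightarrow> bool" where
  "is_last R X w \<longleftrightarrow> w \<in> X \<and> (\<forall>x\<in>X. x \<noteq> w \<longrightarrow> R x w)"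

text \<open>The existential quantifiers only name the first and the last word: both orders are
  total on infinite words, so these are unique, and for \<open>q \<ge> 2\<close> they exist by compactness.\<close>

definition induces_zero_periodicity :: "nat \<Rightarrow> nat list \<Rightarrow> bool" where
  "induces_zero_periodicity q f \<longleftrightarrow>
     (\<forall>p \<in> fin_avoiding q f.
        (\<exists>w. is_first (appropriate_order q) (with_prefix p (inf_avoiding q f)) w
              \<and> has_ultimate_period w [0]) \<and>
        (\<exists>w. is_last (appropriate_order q) (with_prefix p (inf_avoiding q f)) w
              \<and> has_ultimate_period w [0]))"

definition W :: "nat \<Rightarrow> nat list set" where
  "W q = {replicate l (q - 2) @ [q - 1] | l. True}"

end

theory Submission
  imports Defs
begin

text \<open>Reading a symbol of odd weight reverses the order. In either parity of \<open>q\<close>, \<open>q - 1\<close> reverses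
  while \<open>0\<close> and \<open>q - 2\<close> do not. Since \<open>f\<close> ends in \<open>q - 1\<close>, an \<open>f\<close>-free word can always be
  extended by \<open>0\<close> or \<open>q - 2\<close>. So an extremal extension of \<open>p\<close> is \<open>0\<^sup>\<omega>\<close> if it has to be minimised;
  if it has to be maximised, it is \<open>(q - 2)\<^sup>k (q - 1) 0\<^sup>\<omega>\<close> with the least \<open>k\<close> for which this does not
  create \<open>f\<close>. Such a \<open>k\<close> fails to exist for some \<open>p\<close> exactly if \<open>f\<close> is in \<open>W q\<close>, and then the
  extremal extension is \<open>(q - 2)\<^sup>\<omega>\<close>.\<close>

section \<open>Both orders as one order driven by symbol weights\<close>

text \<open>Summed over a common prefix, the weights give \<open>u\<close> for even \<open>q\<close>
  and \<open>u + v\<close> for odd \<open>q\<close>, where each nonzero symbol counts once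
  more.\<close>

definition weight :: "nat \<Rightarrow> nat \<Rightarrow> nat" where
  "weight q a = (if even q \<or> a = 0 then a else Suc a)"

text \<open>An odd offset \<open>b\<close> gives the converse order, which treats first and last words uniformly.\<close>

definition offset_order :: "nat \<Rightarrow> nat \<Rightarrow> nat word \<Rightarrow> nat word \<Rightarrow> bool" where
  "offset_order q b s t \<longleftrightarrow> (\<exists>k. (\<forall>i<k. s i = t i) \<and> s k \<noteq> t k \<and>
     (even (b + (\<Sum>i<k. weight q (s i))) \<longleftrightarrow> s k < t k))"

lemma weight_0 [simp]: "weight q 0 = 0"
  by (simp add: weight_def)

lemma even_weight: "q \<ge> 3 \<Longrightarrow> even (weight q (q - 2))"
  by (auto simp: weight_def)

lemma odd_weight: "q \<ge> 3 \<Longrightarrow> odd (weight q (q - 1))"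
  by (auto simp: weight_def)

lemma appropriate_order_eq: "appropriate_order q = offset_order q 0"
proof (intro ext)
  fix s t :: "nat word"
  \<comment> \<open>Writing \<open>v\<close> as a sum of indicators merges \<open>u + v\<close> into
    a single sum, whose terms are the weights for odd \<open>q\<close>.\<close>
  have "(\<Sum>i<k. s i) + card {i. i < k \<and> s i \<noteq> 0} = (\<Sum>i<k. if s i = 0 then s i else Suc (s i))" for k
  proof -
    have "card {i. i < k \<and> s i \<noteq> 0} = (\<Sum>i<k. if s i = 0 then 0 else 1)"
      by (simp add: sum.If_cases Int_def)
    then have "(\<Sum>i<k. s i) + card {i. i < k \<and> s i \<noteq> 0} = (\<Sum>i<k. s i + (if s i = 0 then 0 else 1))"
      by (simp add: sum.distrib)
    also have "\<dots> = (\<Sum>i<k. if s i = 0 then s i else Suc (s i))"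
      by (intro sum.cong) auto
    finally show ?thesis .
  qed
  then show "appropriate_order q s t = offset_order q 0 s t"
    unfolding appropriate_order_def offset_order_def prec_def tri_def weight_def Let_def
    by (auto simp: linorder_neq_iff)
qed

text \<open>Up to the first difference both words have the same weight sum, and adding 1 to it flips
  the parity, which exchanges \<open><\<close> and \<open>>\<close>.\<close>

lemma offset_order_converse: "offset_order q 0 t s \<longleftrightarrow> offset_order q 1 s t"
proof -
  have "(\<Sum>i<k. weight q (t i)) = (\<Sum>i<k. weight q (s i))" if "\<forall>i<k. s i = t i" for k
    using that by (intro sum.cong) auto
  then show ?thesis
    unfolding offset_order_def
    by (intro ex_cong1) (auto simp: linorder_neq_iff)
qed

lemma ex_first_difference:
  fixes s t :: "'a word"
  assumes "s \<noteq> t"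
  obtains k where "\<forall>i<k. s i = t i" "s k \<noteq> t k"
proof -
  obtain m where "s m \<noteq> t m"
    using assms by blast
  then show thesis
    using that[of "LEAST k. s k \<noteq> t k"] LeastI[of "\<lambda>k. s k \<noteq> t k" m]
      not_less_Least[of _ "\<lambda>k. s k \<noteq> t k"] by blast
qed

section \<open>Occurrences of the forbidden factor\<close>

lemma inf_factor_iff: "inf_factor f w \<longleftrightarrow> (\<exists>i. map w [i..<i + length f] = f)"
proof
  assume "inf_factor f w"
  then obtain u x where w: "w = u \<frown> f \<frown> x"
    by (auto simp: inf_factor_def)
  have "map w [length u..<length u + length f] = f"
    by (rule nth_equalityI) (auto simp: w conc_def)
  then show "\<exists>i. map w [i..<i + length f] = f" ..
next
  assume "\<exists>i. map w [i..<i + length f] = f"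
  then obtain i where i: "map w [i..<i + length f] = f" ..
  have f: "f ! j = w (i + j)" if "j < length f" for j
    by (subst i[symmetric]) (use that in simp)
  have "w = map w [0..<i] \<frown> f \<frown> (\<lambda>n. w (i + length f + n))"
    by (rule ext) (auto simp: conc_def f)
  then show "inf_factor f w"
    unfolding inf_factor_def by blast
qed

lemma inf_avoiding_less: "w \<in> inf_avoiding q f \<Longrightarrow> w i < q"
  by (force simp: inf_avoiding_def inf_words_def alphabet_def)

lemma inf_factor_if_sublist: "sublist f p \<Longrightarrow> inf_factor f (p \<frown> x)"
  unfolding sublist_def inf_factor_def by (metis append_assoc conc_conc)

text \<open>An occurrence reaching into the tail would end in \<open>0\<close>, so it has to lie
  within \<open>p\<close>.\<close>

lemma sublist_if_inf_factor_zeros: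
  assumes "inf_factor f (p \<frown> [0]\<^sup>\<omega>)" "f \<noteq> []" "last f \<noteq> 0"
  shows "sublist f p"
proof -
  let ?w = "p \<frown> [0]\<^sup>\<omega>"
  obtain i where i: "map ?w [i..<i + length f] = f"
    using assms(1) by (auto simp: inf_factor_iff)
  have "last f = ?w (i + length f - 1)"
    by (subst i[symmetric]) (use assms(2) in \<open>simp add: last_map\<close>)
  then have le: "i + length f \<le> length p"
    using assms(2,3) by (cases "i + length f \<le> length p"; cases f) (auto simp: conc_def iter_def split: if_splits)
  have "f = map ?w [i..<i + length f]"
    using i by simp
  also have "\<dots> = take (length f) (drop i p)"
    using le by (intro nth_equalityI) (auto simp: conc_def)
  finally have "p = take i p @ f @ drop (length f) (drop i p)"
    by (metis append_take_drop_id)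
  then show ?thesis
    unfolding sublist_def by blast
qed

text \<open>A new occurrence would have to end at the symbol just appended, which is not the last
  symbol of \<open>f\<close>.\<close>

lemma not_sublist_append_replicate:
  assumes "\<not> sublist f p" "f \<noteq> []" "last f \<noteq> a"
  shows "\<not> sublist f (p @ replicate k a)"
proof (induction k)
  case (Suc k)
  have "\<not> Sublist.suffix f ((p @ replicate k a) @ [a])"
    using assms(2,3) by (auto simp del: append_assoc)
  then show ?case
    using Suc sublist_snoc[of f "p @ replicate k a" a]
    by (simp add: replicate_append_same)
qed (use assms(1) in simp)

text \<open>If every \<open>k\<close> failed, then so would one whose block is longer than
  \<open>butlast f\<close>. The occurrence ends at the final \<open>q - 1\<close> and its other
  symbols all lie in the block, which forces \<open>f\<close> into \<open>W q\<close>.\<close>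

lemma ex_avoiding_extension:
  assumes "\<not> sublist f p" "f \<noteq> []" "last f = q - 1" "q \<ge> 3" "f \<notin> W q"
  shows "\<exists>k. \<not> sublist f (p @ replicate k (q - 2) @ [q - 1])"
proof (rule ccontr)
  let ?k = "length f"
  assume "\<not> ?thesis"
  then have "sublist f ((p @ replicate ?k (q - 2)) @ [q - 1])"
    by simp
  moreover have "\<not> sublist f (p @ replicate ?k (q - 2))"
    using assms by (intro not_sublist_append_replicate) auto
  ultimately have "Sublist.suffix f ((p @ replicate ?k (q - 2)) @ [q - 1])"
    unfolding sublist_snoc by blast
  then have "Sublist.suffix (butlast f) (p @ replicate ?k (q - 2))"
    using assms(2) by (auto simp del: append_assoc)
  then have "Sublist.suffix (butlast f) (replicate ?k (q - 2))"
    by (rule suffix_length_suffix) (auto simp: Sublist.suffix_def)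
  then have "set (butlast f) \<subseteq> {q - 2}"
    using set_mono_suffix by fastforce
  then have "butlast f = replicate (length (butlast f)) (q - 2)"
    by (metis replicate_length_same singletonD subsetD)
  then have "f = replicate (length (butlast f)) (q - 2) @ [q - 1]"
    using assms(2,3) by (metis append_butlast_last_id)
  then have "f \<in> W q"
    unfolding W_def by blast
  then show False
    using assms(5) by blast
qed

lemma append_zeros_avoiding:
  assumes "r \<in> fin_avoiding q f" "f \<noteq> []" "last f \<noteq> 0" "q > 0"
  shows "r \<frown> [0]\<^sup>\<omega> \<in> inf_avoiding q f"
proof -
  have "range (r \<frown> [0]\<^sup>\<omega>) \<subseteq> alphabet q"
    using assms(1,4) by (auto simp: fin_avoiding_def alphabet_def conc_def iter_def in_lists_conv_set)
  moreover have "\<not> inf_factor f (r \<frown> [0]\<^sup>\<omega>)"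
    using assms sublist_if_inf_factor_zeros by (auto simp: fin_avoiding_def)
  ultimately show ?thesis
    by (auto simp: inf_avoiding_def inf_words_def)
qed

section \<open>Extremal words for \<open>f\<close> outside \<open>W q\<close>\<close>

text \<open>The minimum for \<open>offset_order q b\<close> is the first word if
  \<open>b = 0\<close> and the last word if \<open>b = 1\<close>.\<close>

lemma ex_zero_periodic_extremum:
  assumes q: "q \<ge> 3" and f: "f \<noteq> []" "last f = q - 1" "f \<notin> W q"
    and p: "p \<in> fin_avoiding q f"
  shows "\<exists>w \<in> with_prefix p (inf_avoiding q f). has_ultimate_period w [0] \<and>
    (\<forall>x \<in> with_prefix p (inf_avoiding q f). x \<noteq> w \<longrightarrow> offset_order q b w x)"
proof -
  define S where "S m = (\<Sum>a\<leftarrow>m. weight q a)" for m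
  \<comment> \<open>The zero tail has weight 0, so the parity stays fixed from the end of
    \<open>r\<close> on.\<close>
  have sum_conc: "(\<Sum>i<k. weight q ((r \<frown> [0]\<^sup>\<omega>) i)) = S r" if "length r \<le> k" for r k
  proof -
    have "(\<Sum>i<k. weight q ((r \<frown> [0]\<^sup>\<omega>) i)) = (\<Sum>i<length r. weight q ((r \<frown> [0]\<^sup>\<omega>) i))"
      using that by (intro sum.mono_neutral_right) (auto simp: conc_def iter_def)
    also have "\<dots> = S r"
      by (simp add: S_def sum_list_sum_nth conc_def atLeast0LessThan)
    finally show ?thesis .
  qed
  \<comment> \<open>With even parity the smaller symbol comes first, and no symbol is smaller than
    \<open>0\<close>.\<close>
  have zeros: "offset_order q b (r \<frown> [0]\<^sup>\<omega>) x"
    if "even (b + S r)" "length r \<le> k" "\<forall>i<k. (r \<frown> [0]\<^sup>\<omega>) i = x i" "(r \<frown> [0]\<^sup>\<omega>) k \<noteq> x k" for r x k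
  proof -
    have "(r \<frown> [0]\<^sup>\<omega>) k = 0"
      using that(2) by (auto simp: conc_def iter_def)
    then show ?thesis
      unfolding offset_order_def using that sum_conc[of r k] by (intro exI[of _ k]) auto
  qed
  have period: "has_ultimate_period (r \<frown> [0]\<^sup>\<omega>) [0]" for r :: "nat list"
    by (auto simp: has_ultimate_period_def)
  show ?thesis
  proof (cases "even (b + S p)")
    case True
    let ?w = "p \<frown> [0]\<^sup>\<omega>"
    have "?w \<in> with_prefix p (inf_avoiding q f)"
      using append_zeros_avoiding[OF p f(1)] f q by (auto simp: with_prefix_def)
    moreover have "offset_order q b ?w x"
      if x: "x \<in> with_prefix p (inf_avoiding q f)" "x \<noteq> ?w" for x
    proof -
      obtain k where k: "\<forall>i<k. ?w i = x i" "?w k \<noteq> x k"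
        using ex_first_difference x(2) by metis
      have "length p \<le> k"
        using x(1) k(2) by (cases "length p \<le> k") (auto simp: with_prefix_def conc_def)
      then show ?thesis
        using zeros True k by blast
    qed
    ultimately show ?thesis
      using period by blast
  next
    case False
    let ?bad = "\<lambda>k. sublist f (p @ replicate k (q - 2) @ [q - 1])"
    have p': "\<not> sublist f p" "p \<in> lists (alphabet q)"
      using p by (auto simp: fin_avoiding_def)
    \<comment> \<open>The least \<open>k\<close> puts the largest symbol as early as possible; by
      minimality, any competitor with \<open>q - 1\<close> earlier contains
      \<open>f\<close>.\<close>
    define k where "k = (LEAST k. \<not> ?bad k)"
    have good: "\<not> ?bad k"
      unfolding k_def using ex_avoiding_extension[OF p'(1) f(1,2) q f(3)] by (rule LeastI_ex)
    have bad: "?bad j" if "j < k" for j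
      using not_less_Least that unfolding k_def by blast
    define r where "r = p @ replicate k (q - 2) @ [q - 1]"
    let ?w = "r \<frown> [0]\<^sup>\<omega>"
    have "r \<in> fin_avoiding q f"
      using good p'(2) q by (auto simp: r_def fin_avoiding_def alphabet_def)
    then have "?w \<in> with_prefix p (inf_avoiding q f)"
      using append_zeros_avoiding[of r q f] f q
      by (auto simp: with_prefix_def r_def conc_conc[symmetric] simp del: conc_conc)
    moreover have "offset_order q b ?w x"
      if x: "x \<in> with_prefix p (inf_avoiding q f)" "x \<noteq> ?w" for x
    proof -
      obtain y where y: "x = p \<frown> y"
        using x(1) by (auto simp: with_prefix_def)
      have x_lt: "x i < q" for i
        using x(1) inf_avoiding_less by (auto simp: with_prefix_def simp del: range_conc)
      obtain j where j: "\<forall>i<j. ?w i = x i" "?w j \<noteq> x j"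
        using ex_first_difference x(2) by metis
      have le: "length p \<le> j"
        using j(2) by (cases "length p \<le> j") (auto simp: y r_def conc_def nth_append)
      show ?thesis
      proof (cases "length r \<le> j")
        case True
        \<comment> \<open>The block keeps the odd parity reached after \<open>p\<close>, and the
          single \<open>q - 1\<close> makes it even.\<close>
        have "even (b + S r)"
          using False even_weight[OF q] odd_weight[OF q]
          by (auto simp: S_def r_def sum_list_replicate)
        then show ?thesis
          using zeros True j by blast
      next
        case less: False
        \<comment> \<open>The number of symbols after \<open>p\<close> before the first difference;
          \<open>m = k\<close> is the position of \<open>q - 1\<close> in \<open>?w\<close>.\<close>
        define m where "m = j - length p"
        have m: "j = length p + m" "m \<le> k"
          using le less by (auto simp: m_def r_def)
        have pre: "map ?w [0..<j] = p @ replicate m (q - 2)"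
          using m by (intro nth_equalityI) (auto simp: r_def conc_def nth_append)
        have "(\<Sum>i<j. weight q (?w i)) = S (map ?w [0..<j])"
          by (simp add: S_def interv_sum_list_conv_sum_set_nat atLeast0LessThan comp_def)
        then have odd: "odd (b + (\<Sum>i<j. weight q (?w i)))"
          using False even_weight[OF q] unfolding pre by (auto simp: S_def sum_list_replicate)
        \<comment> \<open>The parity is odd here, so the word with the larger symbol comes
          first.\<close>
        have "x j < ?w j"
        proof (cases "m = k")
          case True
          then have "?w j = q - 1"
            using m by (simp add: r_def conc_def nth_append)
          then show ?thesis
            using j(2) x_lt[of j] by simp
        next
          case neq: False
          then have wj: "?w j = q - 2"
            using m by (auto simp: r_def conc_def nth_append)
          \<comment> \<open>Only \<open>q - 1\<close> exceeds \<open>q - 2\<close>, and taking it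
            here would complete one of the bad words.\<close>
          have "x j \<noteq> q - 1"
          proof
            assume xj: "x j = q - 1"
            have "map x [0..<Suc j] = map ?w [0..<j] @ [q - 1]"
              using j(1) xj by simp
            also have "\<dots> = p @ replicate m (q - 2) @ [q - 1]"
              by (simp add: pre)
            finally have "sublist f (map x [0..<Suc j])"
              using bad[of m] m(2) neq by simp
            then have "inf_factor f (map x [0..<Suc j] \<frown> Omega_Words_Fun.suffix (Suc j) x)"
              by (rule inf_factor_if_sublist)
            then show False
              using x(1) prefix_suffix[of x "Suc j"]
              by (auto simp: with_prefix_def inf_avoiding_def subsequence_def)
          qed
          then show ?thesis
            using wj j(2) x_lt[of j] by simp
        qed
        then show ?thesis
          unfolding offset_order_def using odd j by (intro exI[of _ j]) auto
      qed
    qed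
    ultimately show ?thesis
      using period by blast
  qed
qed

lemma induces_zero_periodicity_if_not_W:
  assumes "q \<ge> 3" "f \<noteq> []" "last f = q - 1" "f \<notin> W q"
  shows "induces_zero_periodicity q f"
  unfolding induces_zero_periodicity_def
proof (intro ballI conjI)
  fix p
  assume p: "p \<in> fin_avoiding q f"
  show "\<exists>w. is_first (appropriate_order q) (with_prefix p (inf_avoiding q f)) w
      \<and> has_ultimate_period w [0]"
    unfolding is_first_def appropriate_order_eq
    using ex_zero_periodic_extremum[OF assms p, of 0] by blast
  show "\<exists>w. is_last (appropriate_order q) (with_prefix p (inf_avoiding q f)) w
      \<and> has_ultimate_period w [0]"
    unfolding is_last_def appropriate_order_eq offset_order_converse
    using ex_zero_periodic_extremum[OF assms p, of 1] by blast
qed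

section \<open>Failure of zero periodicity for \<open>f\<close> in \<open>W q\<close>\<close>

text \<open>After the prefix \<open>p\<close> of \<open>l\<close> symbols \<open>q - 2\<close>, the
  constant word \<open>z\<close> is available. A last word with zero tail would have to exceed
  \<open>z\<close>, and doing so creates \<open>f\<close>.\<close>

lemma not_induces_zero_periodicity_if_W:
  assumes q: "q \<ge> 3" and "f \<in> W q"
  shows "\<not> induces_zero_periodicity q f"
proof
  assume ind: "induces_zero_periodicity q f"
  obtain l where f: "f = replicate l (q - 2) @ [q - 1]"
    using assms(2) by (auto simp: W_def)
  define p where "p = replicate l (q - 2)"
  define z :: "nat word" where "z = (\<lambda>_. q - 2)"
  have "\<not> sublist f p"
    by (auto simp: f p_def dest: sublist_length_le)
  then have "p \<in> fin_avoiding q f"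
    using q by (auto simp: fin_avoiding_def p_def alphabet_def)
  then obtain w where w: "is_last (appropriate_order q) (with_prefix p (inf_avoiding q f)) w"
    "has_ultimate_period w [0]"
    using ind unfolding induces_zero_periodicity_def by blast
  then obtain b where b: "w = b \<frown> [0]\<^sup>\<omega>"
    by (auto simp: has_ultimate_period_def)
  \<comment> \<open>The zero tail of \<open>w\<close> starts here, while \<open>q - 2\<close> is
    positive because \<open>q \<ge> 3\<close>.\<close>
  have "w (length b) \<noteq> z (length b)"
    using q by (simp add: b z_def iter_def)
  then have neq: "z \<noteq> w"
    by metis
  have "\<not> inf_factor f z"
  proof
    assume "inf_factor f z"
    then obtain i where i: "map z [i..<i + length f] = f"
      by (auto simp: inf_factor_iff)
    have "q - 1 \<in> set (map z [i..<i + length f])"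
      unfolding i by (simp add: f)
    then show False
      using q by (auto simp: z_def)
  qed
  moreover have "z = p \<frown> z"
    by (auto simp: p_def z_def conc_def)
  ultimately have "z \<in> with_prefix p (inf_avoiding q f)"
    using q by (auto simp: with_prefix_def inf_avoiding_def inf_words_def alphabet_def z_def)
  then have "offset_order q 0 z w"
    using w(1) neq by (auto simp: is_last_def appropriate_order_eq)
  then obtain k where k: "\<forall>i<k. z i = w i" "z k \<noteq> w k"
    "even (\<Sum>i<k. weight q (z i)) \<longleftrightarrow> z k < w k"
    by (auto simp: offset_order_def)
  have w_in: "w \<in> with_prefix p (inf_avoiding q f)"
    using w(1) by (simp add: is_last_def)
  \<comment> \<open>Only copies of \<open>q - 2\<close>, of even weight, precede position
    \<open>k\<close>, so the greater word has the larger symbol, which must be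
    \<open>q - 1\<close>.\<close>
  have "z k < w k"
    using k(3) even_weight[OF q] by (simp add: z_def)
  moreover have "w k < q"
    using w_in inf_avoiding_less by (auto simp: with_prefix_def)
  ultimately have wk: "w k = q - 1"
    by (simp add: z_def)
  have wi: "w i = q - 2" if "i < k" for i
    using k(1) that by (simp add: z_def)
  have "l \<le> k"
    using w_in k(2) by (cases "l \<le> k") (auto simp: with_prefix_def p_def conc_def z_def)
  \<comment> \<open>Since \<open>l \<le> k\<close>, the subtraction is exact: the \<open>l\<close>
    symbols before position \<open>k\<close>, together with \<open>w k\<close>, spell
    \<open>f\<close>.\<close>
  then have "map w [k - l..<(k - l) + length f] = f"
    by (intro nth_equalityI) (auto simp: f nth_append wi wk less_Suc_eq)
  then have "inf_factor f w"
    using inf_factor_iff by blast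
  then show False
    using w_in by (auto simp: with_prefix_def inf_avoiding_def)
qed

theorem theorem3:
  fixes q :: nat and f :: "nat list"
  assumes "q \<ge> 3"
    and "f \<in> lists (alphabet q)" and "f \<noteq> []"
    and "last f = q - 1"
  shows "\<not> induces_zero_periodicity q f \<longleftrightarrow> f \<in> W q"
  using induces_zero_periodicity_if_not_W not_induces_zero_periodicity_if_W assms by blast

end
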